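(* Let $R=GF(2)[X]$, let $p(X)\in R$ be a primitive irreducible polynomial of degree $m>1$, and let $n=2^m-1$. Let $f(X)\in R$ have weight $w$, and write $f(X)=g(X)+h(X)$, where $g(X)\in T_{2i}$ for some integer $i\ge 0$, $h(X)\in R$ has weight $j$, no two exponents of $h(X)$ are congruent modulo $n$, and the terms (monomials) of $g(X)$ and $h(X)$ are disjoint (so $w=2i+j$). Then $f(X)$ is divisible by $p(X)$ if and only if $\phi(h(X))\in A_j$.
   Context: The weight of a polynomial in $R$ is its number of nonzero terms. $T_2$ is the set of polynomials $X^a+X^b\in R$ with $0\le a<b$ and $a\equiv b \pmod n$. For $k\ge 2$, $T_{2k}$ is the set of sums of $k$ disjoint elements of $T_2$ (i.e. all $2k$ monomials involved are distinct); by convention $T_0=\{0\}$. $H$ is the binary Hamming code of length $n$ with generator polynomial $p(X)$, i.e. the set of polynomials of degree $<n$ (identified with residue classes in $R/(X^n-1)$) that are divisible by $p(X)$; $A_w$ denotes the set of codewords of $H$ of weight $w$. For $h(X)\in R$, $\phi(h(X))$ is the polynomial obtained from $h(X)$ by reducing every exponent modulo $n$ (i.e. its image in $R/(X^n-1)$ written as a polynomial of degree $<n$). *)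

theory Defs
  imports "HOL-Library.Z2" "HOL-Library.Disjoint_Sets"
    "HOL-Computational_Algebra.Polynomial" "HOL-Number_Theory.Cong"
begin

text \<open>The ring \<open>R = GF(2)[X]\<close> is the type \<^typ>\<open>bit poly\<close>.\<close>

definition exponents :: "bit poly \<Rightarrow> nat set"
  where "exponents f = {i. coeff f i \<noteq> 0}"

definition weight :: "bit poly \<Rightarrow> nat"
  where "weight f = card (exponents f)"

text \<open>The order condition says that the least \<open>e > 0\<close> with \<open>p dvd X ^ e - 1\<close>
  is \<open>2 ^ m - 1\<close> where \<open>m\<close> is the degree of \<open>p\<close>, i.e. the class of \<open>X\<close> in the
  field \<open>R/(p)\<close> has multiplicative order \<open>2 ^ m - 1\<close> (it is a primitive element).\<close>

definition primitive_poly :: "bit poly \<Rightarrow> bool"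
  where "primitive_poly p \<longleftrightarrow> irreducible p \<and>
    p dvd monom 1 (2 ^ degree p - 1) - 1 \<and>
    (\<forall>e. 0 < e \<and> e < 2 ^ degree p - 1 \<longrightarrow> \<not> p dvd monom 1 e - 1)"

definition T2 :: "nat \<Rightarrow> bit poly set"
  where "T2 n = {monom 1 a + monom 1 b | a b. a < b \<and> [a = b] (mod n)}"

text \<open>\<open>T n k\<close> is the set written \<open>T\<^sub>2\<^sub>k\<close>: the second argument is the number of
  binomials, half the weight. For \<open>k = 0\<close> the sum is empty.\<close>

definition T :: "nat \<Rightarrow> nat \<Rightarrow> bit poly set"
  where "T n k = {(\<Sum>l<k. u l) | u.
    (\<forall>l<k. u l \<in> T2 n) \<and> disjoint_family_on (\<lambda>l. exponents (u l)) {..<k}}"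

definition hamming_code :: "bit poly \<Rightarrow> nat \<Rightarrow> bit poly set"
  where "hamming_code p n = {c. degree c < n \<and> p dvd c}"

definition codewords_of_weight :: "bit poly \<Rightarrow> nat \<Rightarrow> nat \<Rightarrow> bit poly set"
  where "codewords_of_weight p n w = {c \<in> hamming_code p n. weight c = w}"

definition phi :: "nat \<Rightarrow> bit poly \<Rightarrow> bit poly"
  where "phi n h = (\<Sum>i\<le>degree h. monom (coeff h i) (i mod n))"

lemma finite_exponents [simp]: "finite (exponents f)"
  unfolding exponents_def using MOST_coeff_eq_0[of f] by (simp add: eventually_cofinite)

lemma exponents_0 [simp]: "exponents 0 = {}"
  by (simp add: exponents_def)

lemma exponents_add_disjoint:
  assumes "exponents f \<inter> exponents g = {}"
  shows "exponents (f + g) = exponents f \<union> exponents g"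
  using assms unfolding exponents_def by (auto simp: disjoint_iff)

lemma weight_add_disjoint:
  assumes "exponents f \<inter> exponents g = {}"
  shows "weight (f + g) = weight f + weight g"
  using assms by (simp add: weight_def exponents_add_disjoint card_Un_disjoint)

lemma weight_T2:
  assumes "u \<in> T2 n"
  shows "weight u = 2"
proof -
  obtain a b where u: "u = monom 1 a + monom 1 b" and ab: "a < b"
    using assms by (auto simp: T2_def)
  have "exponents u = {a, b}"
    using ab by (auto simp: u exponents_def coeff_add coeff_monom split: if_splits)
  then show ?thesis
    using ab by (simp add: weight_def)
qed

lemma T_0: "T n 0 = {0}"
  by (simp add: T_def disjoint_family_on_def)

lemma T_1: "T n 1 = T2 n"
proof
  show "T n 1 \<subseteq> T2 n"
    by (auto simp: T_def)
  show "T2 n \<subseteq> T n 1"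
  proof
    fix v assume "v \<in> T2 n"
    then show "v \<in> T n 1"
      by (auto simp: T_def disjoint_family_on_def intro!: exI[of _ "\<lambda>_. v"])
  qed
qed

lemma weight_T:
  assumes "g \<in> T n k"
  shows "weight g = 2 * k"
proof -
  obtain u where g: "g = (\<Sum>l<k. u l)" and u: "\<And>l. l < k \<Longrightarrow> u l \<in> T2 n"
    and disj: "disjoint_family_on (\<lambda>l. exponents (u l)) {..<k}"
    using assms by (auto simp: T_def)
  have "exponents (\<Sum>l<j. u l) = (\<Union>l<j. exponents (u l)) \<and> weight (\<Sum>l<j. u l) = 2 * j"
    if "j \<le> k" for j
    using that
  proof (induction j)
    case 0
    then show ?case by (simp add: weight_def)
  next
    case (Suc j)
    then have IH: "exponents (\<Sum>l<j. u l) = (\<Union>l<j. exponents (u l))"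
      "weight (\<Sum>l<j. u l) = 2 * j" by auto
    have d: "exponents (\<Sum>l<j. u l) \<inter> exponents (u j) = {}"
    proof -
      have "exponents (u l) \<inter> exponents (u j) = {}" if "l < j" for l
        using disj Suc.prems that by (auto simp: disjoint_family_on_def)
      then show ?thesis unfolding IH by blast
    qed
    show ?case
      using exponents_add_disjoint[OF d] weight_add_disjoint[OF d] IH weight_T2[OF u[of j]] Suc.prems
      by (auto simp: lessThan_Suc add.commute)
  qed
  then show ?thesis using g by blast
qed

end

theory Submission
  imports Defs
begin

text \<open>Since \<open>X ^ n = 1\<close> modulo \<open>p\<close>, reducing exponents modulo \<open>n\<close> does not change residue
  classes modulo \<open>p\<close>. Hence \<open>p\<close> divides every binomial of \<open>T\<^sub>2\<close>, so it divides \<open>g\<close>, and it also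
  divides the difference of \<open>h\<close> and \<open>\<phi>(h)\<close>. The weight of \<open>\<phi>(h)\<close> is that of \<open>h\<close> because no two
  terms of \<open>h\<close> collide.\<close>

text \<open>With \<open>a = n * k + r\<close> the difference is \<open>c X^r ((X^n)^k - 1)\<close>,
  and the geometric sum splits off the factor \<open>X^n - 1\<close>.\<close>

lemma monom_mod_dvd:
  fixes c :: "'a::comm_ring_1"
  shows "monom 1 n - 1 dvd monom c a - monom c (a mod n)"
proof -
  let ?k = "a div n" and ?r = "a mod n"
  have "monom c a = monom c ?r * monom 1 n ^ ?k"
    by (simp add: monom_power mult_monom)
  then have "monom c a - monom c ?r = monom c ?r * (monom 1 n ^ ?k - 1)"
    by (simp add: algebra_simps)
  also have "\<dots> = (monom 1 n - 1) * (monom c ?r * (\<Sum>l<?k. monom 1 n ^ l))"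
    by (simp only: power_diff_1_eq mult.left_commute)
  finally show ?thesis
    by (rule dvdI)
qed

lemma dvd_T2:
  assumes p: "p dvd monom 1 n - 1" and u: "u \<in> T2 n"
  shows "p dvd u"
proof -
  obtain a b where u': "u = monom 1 a + monom 1 b" and ab: "a mod n = b mod n"
    using u by (auto simp: T2_def cong_def)
  \<comment> \<open>Sum and difference agree in characteristic 2; in the difference the common
    residue monomial can be inserted and cancels.\<close>
  have "u = monom 1 a - monom 1 b"
    by (rule poly_eqI) (simp add: u')
  also have "\<dots> = (monom 1 a - monom 1 (a mod n)) - (monom 1 b - monom 1 (b mod n))"
    by (simp add: ab)
  also have "p dvd \<dots>"
    by (rule dvd_diff) (rule dvd_trans[OF p monom_mod_dvd])+
  finally show ?thesis .
qed

lemma dvd_T: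
  assumes "p dvd monom 1 n - 1" and "g \<in> T n k"
  shows "p dvd g"
proof -
  obtain u where g: "g = (\<Sum>l<k. u l)" and u: "\<And>l. l < k \<Longrightarrow> u l \<in> T2 n"
    using assms(2) by (auto simp: T_def)
  show ?thesis
    unfolding g by (rule dvd_sum) (simp add: dvd_T2[OF assms(1) u])
qed

lemma dvd_minus_phi:
  assumes "p dvd monom 1 n - 1"
  shows "p dvd h - phi n h"
proof -
  have "h - phi n h = (\<Sum>i\<le>degree h. monom (coeff h i) i - monom (coeff h i) (i mod n))"
    using poly_as_sum_of_monoms[of h] by (simp add: phi_def sum_subtractf)
  also have "p dvd \<dots>"
    by (rule dvd_sum) (rule dvd_trans[OF assms monom_mod_dvd])
  finally show ?thesis .
qed

lemma degree_phi_less: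
  assumes "n > 0"
  shows "degree (phi n h) < n"
proof -
  \<comment> \<open>\<open>degree_sum_le\<close> takes a non-strict bound, hence
    \<open>n - 1\<close>.\<close>
  have "degree (monom (coeff h i) (i mod n)) \<le> n - 1" for i
    using degree_monom_le[of "coeff h i" "i mod n"] mod_less_divisor[OF assms, of i] by linarith
  then have "degree (phi n h) \<le> n - 1"
    unfolding phi_def by (intro degree_sum_le) auto
  with assms show ?thesis
    by linarith
qed

text \<open>A nonzero coefficient in GF(2) is 1, so the exponent set alone determines the
  sum.\<close>

lemma phi_eq_sum_exponents: "phi n h = (\<Sum>i\<in>exponents h. monom 1 (i mod n))"
proof -
  have "phi n h = (\<Sum>i\<in>exponents h. monom (coeff h i) (i mod n))"
    unfolding phi_def
    by (rule sum.mono_neutral_right) (auto simp: exponents_def le_degree)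
  also have "\<dots> = (\<Sum>i\<in>exponents h. monom 1 (i mod n))"
    by (rule sum.cong) (auto simp: exponents_def)
  finally show ?thesis .
qed

lemma exponents_sum_monom:
  assumes "finite A"
  shows "exponents (\<Sum>i\<in>A. monom 1 i) = A"
  using assms by (auto simp: exponents_def coeff_sum)

lemma weight_phi:
  assumes inj: "inj_on (\<lambda>i. i mod n) (exponents h)"
  shows "weight (phi n h) = weight h"
proof -
  \<comment> \<open>Injectivity permits reindexing by residues: each monomial occurs once, so none
    cancel modulo 2.\<close>
  have "phi n h = (\<Sum>k\<in>(\<lambda>i. i mod n) ` exponents h. monom 1 k)"
    by (simp add: phi_eq_sum_exponents sum.reindex[OF inj])
  then have "exponents (phi n h) = (\<lambda>i. i mod n) ` exponents h"
    by (simp add: exponents_sum_monom)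
  then show ?thesis
    by (simp add: weight_def card_image[OF inj])
qed

theorem theorem2:
  fixes p f g h :: "bit poly" and m n w i j :: nat
  assumes "primitive_poly p" and "degree p = m" and "m > 1" and "n = 2 ^ m - 1"
    and "weight f = w"
    and "f = g + h"
    and "g \<in> T n i"
    and "weight h = j"
    and "\<forall>a\<in>exponents h. \<forall>b\<in>exponents h. a \<noteq> b \<longrightarrow> \<not> [a = b] (mod n)"
    and "exponents g \<inter> exponents h = {}"
  shows "p dvd f \<longleftrightarrow> phi n h \<in> codewords_of_weight p n j"
proof -
  have p: "p dvd monom 1 n - 1"
    using assms(1,2,4) by (simp add: primitive_poly_def)
  have "n > 0"
    using assms(3,4) one_less_power[of "2::nat" m] by simp
  have "inj_on (\<lambda>i. i mod n) (exponents h)"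
    using assms(9) by (auto simp: inj_on_def cong_def)
  then have "weight (phi n h) = j"
    using assms(8) by (simp add: weight_phi)
  have "p dvd f \<longleftrightarrow> p dvd h"
    using dvd_T[OF p assms(7)] by (simp add: assms(6) dvd_add_right_iff)
  also have "\<dots> \<longleftrightarrow> p dvd phi n h"
    using dvd_add_right_iff[OF dvd_minus_phi[OF p], of h "phi n h"] by simp
  \<comment> \<open>The degree and weight conditions on a codeword already hold for
    \<open>phi n h\<close>; only divisibility remains.\<close>
  also have "\<dots> \<longleftrightarrow> phi n h \<in> codewords_of_weight p n j"
    using degree_phi_less[OF \<open>n > 0\<close>] \<open>weight (phi n h) = j\<close>
    by (simp add: codewords_of_weight_def hamming_code_def)
  finally show ?thesis .
qed

end
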